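(* The upper triangular matrix ring $T_n(R)$ is VNL if and only if $n=2$ or $3$ and $R$ is a division ring.
   Context: $R$ is a ring (associative with identity), and $T_n(R)$ denotes the ring of $n\times n$ upper triangular matrices over $R$. An element $a$ of a ring is (von Neumann) regular if $a=aba$ for some $b$ in the ring. A ring is VNL if for each element $a$ of it, either $a$ or $1-a$ is regular.
   Formalization: The formal statement assumes n ≥ 2 and that R is a nonzero ring; without these the claim fails, since T_1(R) = R is VNL for every division ring R, and T_n of the zero ring is VNL for every n. *)

theory Defs
  imports "Jordan_Normal_Form.Matrix"
begin

definition vn_regular :: "('a, 'b) ring_scheme \<Rightarrow> 'a \<Rightarrow> bool" where
  "vn_regular R a \<longleftrightarrow>
     a \<in> carrier R \<and> (\<exists>b\<in>carrier R. a = a \<otimes>\<^bsub>R\<^esub> b \<otimes>\<^bsub>R\<^esub> a)"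

definition VNL_ring :: "('a, 'b) ring_scheme \<Rightarrow> bool" where
  "VNL_ring R \<longleftrightarrow>
     ring R \<and> (\<forall>a\<in>carrier R. vn_regular R a \<or> vn_regular R (\<one>\<^bsub>R\<^esub> \<ominus>\<^bsub>R\<^esub> a))"

text \<open>
  The library class \<open>division_ring\<close> carries a chosen inverse operation; here being a division
  ring is a property of a given ring. The condition \<open>0 \<noteq> 1\<close> is part of the class \<open>ring_1\<close>.
\<close>

definition is_division_ring :: "'a::ring_1 itself \<Rightarrow> bool" where
  "is_division_ring _ \<longleftrightarrow> (\<forall>x::'a. x \<noteq> 0 \<longrightarrow> (\<exists>y. x * y = 1 \<and> y * x = 1))"

definition upper_triangular_ring :: "'a::ring_1 itself \<Rightarrow> nat \<Rightarrow> 'a mat ring" where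
  "upper_triangular_ring ty n =
     (ring_mat ty n ())\<lparr>carrier := {A \<in> carrier_mat n n. upper_triangular A}\<rparr>"

lemma upper_triangular_ring_simps:
  "carrier (upper_triangular_ring ty n) = {A \<in> carrier_mat n n. upper_triangular A}"
  "mult (upper_triangular_ring ty n) = (*)"
  "add (upper_triangular_ring ty n) = (+)"
  "one (upper_triangular_ring ty n) = 1\<^sub>m n"
  "zero (upper_triangular_ring ty n) = 0\<^sub>m n n"
  by (simp_all add: upper_triangular_ring_def ring_mat_simps)

lemma upper_triangular_mult:
  fixes A B :: "'a::semiring_0 mat"
  assumes A: "A \<in> carrier_mat n n" "upper_triangular A"
    and B: "B \<in> carrier_mat n n" "upper_triangular B"
  shows "upper_triangular (A * B)"
proof (rule upper_triangularI)
  fix i j assume ij: "j < i" "i < dim_row (A * B)"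
  with A B have i: "i < n" "j < n" by auto
  have "(A * B) $$ (i, j) = (\<Sum>k = 0..<n. A $$ (i, k) * B $$ (k, j))"
    using A B i by (simp add: scalar_prod_def)
  also have "\<dots> = 0"
  proof (rule sum.neutral, rule ballI)
    fix k assume k: "k \<in> {0..<n}"
    show "A $$ (i, k) * B $$ (k, j) = 0"
    proof (cases "k < i")
      case True
      then have "A $$ (i, k) = 0" using A i by auto
      then show ?thesis by simp
    next
      case False
      then have "B $$ (k, j) = 0" using B k ij by auto
      then show ?thesis by simp
    qed
  qed
  finally show "(A * B) $$ (i, j) = 0" .
qed

lemma ring_upper_triangular_ring: "ring (upper_triangular_ring TYPE('a::ring_1) n)"
proof (rule ringI)
  let ?T = "upper_triangular_ring TYPE('a) n"
  show "abelian_group ?T"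
  proof (rule abelian_groupI)
    fix A assume A: "A \<in> carrier ?T"
    then have "- A \<in> carrier ?T" "- A \<oplus>\<^bsub>?T\<^esub> A = \<zero>\<^bsub>?T\<^esub>"
      by (auto simp: upper_triangular_ring_simps upper_triangular_def)
    then show "\<exists>B\<in>carrier ?T. B \<oplus>\<^bsub>?T\<^esub> A = \<zero>\<^bsub>?T\<^esub>" by blast
  qed (auto simp: upper_triangular_ring_simps upper_triangular_def algebra_simps
        intro: comm_add_mat)
  show "monoid ?T"
    by (rule monoidI)
      (auto simp: upper_triangular_ring_simps intro: upper_triangular_mult assoc_mult_mat)
qed (auto simp: upper_triangular_ring_simps add_mult_distrib_mat mult_add_distrib_mat)

lemma upper_triangular_ring_minus:
  fixes A B :: "'a::ring_1 mat"
  assumes "A \<in> carrier (upper_triangular_ring TYPE('a) n)"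
    and "B \<in> carrier (upper_triangular_ring TYPE('a) n)"
  shows "A \<ominus>\<^bsub>upper_triangular_ring TYPE('a) n\<^esub> B = A - B"
proof -
  let ?T = "upper_triangular_ring TYPE('a) n"
  interpret ring ?T by (rule ring_upper_triangular_ring)
  have mB: "- B \<in> carrier ?T" "- B \<oplus>\<^bsub>?T\<^esub> B = \<zero>\<^bsub>?T\<^esub>"
    using assms by (auto simp: upper_triangular_ring_simps upper_triangular_def)
  then have "\<ominus>\<^bsub>?T\<^esub> B = - B"
    using assms(2) minus_equality by blast
  then show ?thesis
    using assms by (auto simp: a_minus_def upper_triangular_ring_simps intro!: eq_matI)
qed

end

theory Submission
  imports Defs
begin

text \<open>
  If \<open>M\<close> is regular and its diagonal block at \<open>i, i + 1\<close> is \<open>[[f, b], [0, f]]\<close> with \<open>f\<close> idempotent,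
  then \<open>(1 - f) b (1 - f) = 0\<close>. Placing \<open>[[0, 1], [0, 0]]\<close> and \<open>[[1, 1], [0, 1]]\<close> side by side on the
  diagonal therefore excludes \<open>n \<ge> 4\<close>, and the block \<open>[[e, 1], [0, e]]\<close> shows that \<open>R\<close> has no
  nontrivial idempotents. The matrix \<open>diag(x, 1 - x, 0, \<dots>)\<close> shows that each \<open>x\<close> is regular, so \<open>R\<close>
  is a division ring. Conversely, over a division ring a triangular matrix with at most one zero on
  the diagonal is regular, and for \<open>n \<le> 3\<close> this applies to \<open>A\<close> or to \<open>1 - A\<close>.
\<close>

section \<open>Entries of triangular products and their use for regularity\<close>

text \<open>Terms outside \<open>i..j\<close> contain an entry from below the diagonal. On the
  diagonal one term is left, on the superdiagonal two.\<close>

lemma upper_triangular_mult_index: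
  fixes A B :: "'a::semiring_0 mat"
  assumes "A \<in> carrier_mat n n" "upper_triangular A"
    and "B \<in> carrier_mat n n" "upper_triangular B"
    and "i < n" "j < n"
  shows "(A * B) $$ (i, j) = (\<Sum>k = i..j. A $$ (i, k) * B $$ (k, j))"
proof -
  have "(A * B) $$ (i, j) = (\<Sum>k = 0..<n. A $$ (i, k) * B $$ (k, j))"
    using assms by (simp add: scalar_prod_def)
  also have "\<dots> = (\<Sum>k = i..j. A $$ (i, k) * B $$ (k, j))"
  proof (rule sum.mono_neutral_right)
    show "\<forall>k\<in>{0..<n} - {i..j}. A $$ (i, k) * B $$ (k, j) = 0"
    proof
      fix k assume k: "k \<in> {0..<n} - {i..j}"
      then consider "k < i" | "j < k" by fastforce
      then show "A $$ (i, k) * B $$ (k, j) = 0"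
        using assms k by cases (auto dest: upper_triangularD)
    qed
  qed (use assms in auto)
  finally show ?thesis .
qed

lemma vn_regular_upper_triangular_iff:
  fixes A :: "'a::ring_1 mat"
  shows "vn_regular (upper_triangular_ring TYPE('a) n) A \<longleftrightarrow>
    A \<in> carrier_mat n n \<and> upper_triangular A \<and>
    (\<exists>B\<in>carrier_mat n n. upper_triangular B \<and> A = A * B * A)"
  by (auto simp: vn_regular_def upper_triangular_ring_simps)

lemma VNL_upper_triangular_iff:
  "VNL_ring (upper_triangular_ring TYPE('a::ring_1) n) \<longleftrightarrow>
    (\<forall>A::'a mat\<in>carrier_mat n n. upper_triangular A \<longrightarrow>
      vn_regular (upper_triangular_ring TYPE('a) n) A \<or>
      vn_regular (upper_triangular_ring TYPE('a) n) (1\<^sub>m n - A))"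
proof -
  let ?T = "upper_triangular_ring TYPE('a) n"
  have "\<one>\<^bsub>?T\<^esub> \<ominus>\<^bsub>?T\<^esub> A = 1\<^sub>m n - A" if "A \<in> carrier ?T" for A :: "'a mat"
    using upper_triangular_ring_minus[of "1\<^sub>m n" n A] that
    by (simp add: upper_triangular_ring_simps)
  then show ?thesis
    by (auto simp: VNL_ring_def ring_upper_triangular_ring upper_triangular_ring_simps)
qed

text \<open>Taking the entry at \<open>(i, i)\<close> is multiplicative on triangular matrices, so
  it preserves regularity.\<close>

lemma vn_regular_upper_triangular_diagonal:
  fixes A :: "'a::ring_1 mat"
  assumes "vn_regular (upper_triangular_ring TYPE('a) n) A" and i: "i < n"
  shows "\<exists>y. A $$ (i, i) = A $$ (i, i) * y * A $$ (i, i)"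
proof -
  obtain B where A: "A \<in> carrier_mat n n" "upper_triangular A"
    and B: "B \<in> carrier_mat n n" "upper_triangular B" and eq: "A = A * B * A"
    using assms unfolding vn_regular_upper_triangular_iff by blast
  have AB: "A * B \<in> carrier_mat n n" "upper_triangular (A * B)"
    using A B upper_triangular_mult by auto
  have "A $$ (i, i) = (A * B * A) $$ (i, i)"
    using eq by simp
  also have "\<dots> = A $$ (i, i) * B $$ (i, i) * A $$ (i, i)"
    using i upper_triangular_mult_index[OF AB A i i] upper_triangular_mult_index[OF A B i i]
    by simp
  finally show ?thesis by blast
qed

text \<open>In the entry of \<open>A * B * A\<close> at \<open>(i, Suc i)\<close> every term has
  \<open>f\<close> as its leftmost or rightmost factor, and \<open>1 - f\<close> annihilates
  \<open>f\<close> on either side.\<close>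

lemma vn_regular_upper_triangular_superdiagonal:
  fixes A :: "'a::ring_1 mat"
  assumes "vn_regular (upper_triangular_ring TYPE('a) n) A" and i: "Suc i < n"
    and f: "A $$ (i, i) = f" "A $$ (Suc i, Suc i) = f" "f * f = f"
  shows "(1 - f) * A $$ (i, Suc i) * (1 - f) = 0"
proof -
  obtain B where A: "A \<in> carrier_mat n n" "upper_triangular A"
    and B: "B \<in> carrier_mat n n" "upper_triangular B" and eq: "A = A * B * A"
    using assms unfolding vn_regular_upper_triangular_iff by blast
  have AB: "A * B \<in> carrier_mat n n" "upper_triangular (A * B)"
    using A B upper_triangular_mult by auto
  let ?b = "A $$ (i, Suc i)"
  have i': "i < n" using i by simp
  have "?b = (A * B * A) $$ (i, Suc i)"
    using eq by simp
  also have "\<dots> = f * (B $$ (i, i) * ?b) +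
      (f * B $$ (i, Suc i) + ?b * B $$ (Suc i, Suc i)) * f"
    using upper_triangular_mult_index[OF AB A i' i] upper_triangular_mult_index[OF A B i' i]
      upper_triangular_mult_index[OF A B i' i'] f by (simp add: mult.assoc)
  finally have "(1 - f) * ?b * (1 - f) = (1 - f) * (f * (B $$ (i, i) * ?b) +
      (f * B $$ (i, Suc i) + ?b * B $$ (Suc i, Suc i)) * f) * (1 - f)"
    by simp
  also have "\<dots> = ((1 - f) * f) * (B $$ (i, i) * ?b) * (1 - f) +
      (1 - f) * (f * B $$ (i, Suc i) + ?b * B $$ (Suc i, Suc i)) * (f * (1 - f))"
    by (simp only: distrib_left distrib_right mult.assoc)
  also have "\<dots> = 0"
    using f(3) by (simp add: left_diff_distrib right_diff_distrib)
  finally show ?thesis .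
qed

section \<open>Consequences of the VNL property\<close>

lemma VNL_upper_triangular_imp_le_3:
  assumes "VNL_ring (upper_triangular_ring TYPE('a::ring_1) n)"
  shows "n \<le> 3"
proof (rule ccontr)
  assume "\<not> n \<le> 3"
  then have n: "3 < n" by simp
  \<comment> \<open>The obstruction is used with \<open>f = 0\<close> both times: at rows 0, 1 of
    \<open>A\<close>, and at rows 2, 3 of \<open>1 - A\<close>, where the block becomes
    \<open>[[0, -1], [0, 0]]\<close>.\<close>
  define A :: "'a mat" where
    "A = mat n n (\<lambda>(i, j). if (i, j) \<in> {(0, 1), (2, 2), (2, 3), (3, 3)} then 1 else 0)"
  have A: "A \<in> carrier_mat n n" "upper_triangular A"
    unfolding A_def by (auto intro!: upper_triangularI)
  have "\<not> vn_regular (upper_triangular_ring TYPE('a) n) A"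
    using vn_regular_upper_triangular_superdiagonal[of n A 0 0] n by (auto simp: A_def)
  moreover have "\<not> vn_regular (upper_triangular_ring TYPE('a) n) (1\<^sub>m n - A)"
    using vn_regular_upper_triangular_superdiagonal[of n "1\<^sub>m n - A" 2 0] n
    by (auto simp: A_def)
  ultimately show False
    using assms A unfolding VNL_upper_triangular_iff by blast
qed

lemma VNL_upper_triangular_imp_regular:
  fixes x :: "'a::ring_1"
  assumes "VNL_ring (upper_triangular_ring TYPE('a) n)" "2 \<le> n"
  shows "\<exists>y. x = x * y * x"
proof -
  \<comment> \<open>The entry \<open>x\<close> occurs on the diagonal of \<open>A\<close> at 0 and
    of \<open>1 - A\<close> at 1, so either alternative makes \<open>x\<close> regular.\<close>
  define A where
    "A = mat n n (\<lambda>(i, j). if i = 0 \<and> j = 0 then x else if i = 1 \<and> j = 1 then 1 - x else 0)"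
  have A: "A \<in> carrier_mat n n" "upper_triangular A"
    unfolding A_def by (auto intro!: upper_triangularI)
  have "A $$ (0, 0) = x" "(1\<^sub>m n - A) $$ (1, 1) = x"
    using assms(2) by (simp_all add: A_def)
  moreover have "vn_regular (upper_triangular_ring TYPE('a) n) A \<or>
      vn_regular (upper_triangular_ring TYPE('a) n) (1\<^sub>m n - A)"
    using assms A unfolding VNL_upper_triangular_iff by blast
  ultimately show ?thesis
    using vn_regular_upper_triangular_diagonal[of n A 0]
      vn_regular_upper_triangular_diagonal[of n "1\<^sub>m n - A" 1] assms(2) by auto
qed

lemma VNL_upper_triangular_imp_trivial_idempotents:
  fixes e :: "'a::ring_1"
  assumes "VNL_ring (upper_triangular_ring TYPE('a) n)" "2 \<le> n" and e: "e * e = e"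
  shows "e = 0 \<or> e = 1"
proof -
  \<comment> \<open>Regularity of \<open>A\<close> gives \<open>(1 - e) * (1 - e) = 0\<close>.
    Regularity of \<open>1 - A\<close>, with \<open>f = 1 - e\<close> and superdiagonal entry
    \<open>-1\<close>, gives \<open>- (e * e) = 0\<close>.\<close>
  define A where
    "A = mat n n (\<lambda>(i, j). if i = j then e else if i = 0 \<and> j = 1 then 1 else 0)"
  have A: "A \<in> carrier_mat n n" "upper_triangular A"
    unfolding A_def by (auto intro!: upper_triangularI)
  have e': "(1 - e) * (1 - e) = 1 - e"
    using e by (simp add: algebra_simps)
  have "1 - e = 0" if "vn_regular (upper_triangular_ring TYPE('a) n) A"
    using vn_regular_upper_triangular_superdiagonal[OF that, of 0 e] assms(2) e e'
    by (simp add: A_def)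
  moreover have "e = 0" if "vn_regular (upper_triangular_ring TYPE('a) n) (1\<^sub>m n - A)"
    using vn_regular_upper_triangular_superdiagonal[OF that, of 0 "1 - e"] assms(2) e e'
    by (simp add: A_def)
  ultimately show ?thesis
    using assms A unfolding VNL_upper_triangular_iff by (metis eq_iff_diff_eq_0)
qed

text \<open>If \<open>x = x * y * x\<close> is nonzero, then \<open>x * y\<close> and
  \<open>y * x\<close> are nonzero idempotents, hence both are 1.\<close>

lemma VNL_upper_triangular_imp_division_ring:
  assumes "VNL_ring (upper_triangular_ring TYPE('a::ring_1) n)" "2 \<le> n"
  shows "is_division_ring TYPE('a)"
  unfolding is_division_ring_def
proof (intro allI impI)
  fix x :: 'a assume "x \<noteq> 0"
  obtain y where y: "x = x * y * x"
    using VNL_upper_triangular_imp_regular[OF assms] by blast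
  have "(x * y) * (x * y) = x * y" "(y * x) * (y * x) = y * x"
    using y by (metis mult.assoc)+
  then have "x * y = 0 \<or> x * y = 1" "y * x = 0 \<or> y * x = 1"
    using VNL_upper_triangular_imp_trivial_idempotents[OF assms] by blast+
  moreover have "x * y \<noteq> 0" "y * x \<noteq> 0"
    using y \<open>x \<noteq> 0\<close> by (metis mult_zero_left mult_zero_right mult.assoc)+
  ultimately show "\<exists>y. x * y = 1 \<and> y * x = 1" by blast
qed

section \<open>Triangular matrices over a division ring\<close>

text \<open>Induction splits off the last row and column: \<open>[[P, v], [0, D]]\<close> has the
  inverse \<open>[[Q, - Q v C], [0, C]]\<close>, where \<open>Q\<close> and \<open>C\<close> are
  inverse to \<open>P\<close> and \<open>D\<close>.\<close>

lemma upper_triangular_inverse: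
  fixes A :: "'a::ring_1 mat"
  assumes "A \<in> carrier_mat n n" "upper_triangular A"
    and "\<And>i. i < n \<Longrightarrow> \<exists>b. A $$ (i, i) * b = 1 \<and> b * A $$ (i, i) = 1"
  shows "\<exists>B\<in>carrier_mat n n. upper_triangular B \<and> A * B = 1\<^sub>m n \<and> B * A = 1\<^sub>m n"
  using assms
proof (induction n arbitrary: A)
  case 0
  then show ?case
    by (intro bexI[of _ "1\<^sub>m 0"]) auto
next
  case (Suc n)
  define P where "P = mat n n (\<lambda>(i, j). A $$ (i, j))"
  define v where "v = mat n 1 (\<lambda>(i, j). A $$ (i, n))"
  define D where "D = mat 1 1 (\<lambda>(i, j). A $$ (n, n))"
  have car: "P \<in> carrier_mat n n" "v \<in> carrier_mat n 1" "D \<in> carrier_mat 1 1"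
    by (auto simp: P_def v_def D_def)
  have A: "A = four_block_mat P v (0\<^sub>m 1 n) D"
    using Suc.prems(1,2)
    by (intro eq_matI) (auto simp: P_def v_def D_def less_Suc_eq dest: upper_triangularD)
  have "\<exists>b. P $$ (i, i) * b = 1 \<and> b * P $$ (i, i) = 1" if "i < n" for i
    using Suc.prems(3)[of i] that by (simp add: P_def)
  moreover have "upper_triangular P"
    using Suc.prems(1,2) by (auto simp: P_def upper_triangularD intro!: upper_triangularI)
  ultimately obtain Q where Q: "Q \<in> carrier_mat n n" "upper_triangular Q"
    "P * Q = 1\<^sub>m n" "Q * P = 1\<^sub>m n"
    using Suc.IH[OF car(1)] by blast
  obtain d where d: "A $$ (n, n) * d = 1" "d * A $$ (n, n) = 1"
    using Suc.prems(3)[of n] by blast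
  define C where "C = mat 1 1 (\<lambda>(i::nat, j::nat). d)"
  have C: "C \<in> carrier_mat 1 1" "D * C = 1\<^sub>m 1" "C * D = 1\<^sub>m 1"
    using d by (auto simp: C_def D_def scalar_prod_def)
  define w where "w = - (Q * v * C)"
  define B where "B = four_block_mat Q w (0\<^sub>m 1 n) C"
  have w: "w \<in> carrier_mat n 1"
    using Q C car by (auto simp: w_def)
  have neg: "X + - X = 0\<^sub>m n 1" if "X \<in> carrier_mat n 1" for X :: "'a mat"
    using that by auto
  have "P * (Q * v * C) = (P * Q) * v * C"
    using Q(1) C(1) car by (simp add: assoc_mult_mat[of _ n n _ n _ 1] assoc_mult_mat[of _ n n _ 1 _ 1])
  then have Pw: "P * w + v * C = 0\<^sub>m n 1"
    using Q C car by (simp add: w_def)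
  have "Q * v * C * D = Q * v * (C * D)"
    by (rule assoc_mult_mat) (use Q(1) C(1) car in auto)
  then have wD: "Q * v + w * D = 0\<^sub>m n 1"
    using Q C car neg[of "Q * v"] by (simp add: w_def)
  have one: "four_block_mat (1\<^sub>m n) (0\<^sub>m n 1) (0\<^sub>m 1 n) (1\<^sub>m 1) = (1\<^sub>m (Suc n) :: 'a mat)"
    by (intro eq_matI) auto
  have "B \<in> carrier_mat (Suc n) (Suc n)"
    using four_block_carrier_mat[OF Q(1) C(1)] by (simp add: B_def)
  moreover have "upper_triangular B"
    using Q C w by (auto simp: B_def less_Suc_eq upper_triangularD intro!: upper_triangularI)
  moreover have "A * B = 1\<^sub>m (Suc n)"
    using Q C car w Pw one unfolding A B_def
    by (subst mult_four_block_mat[of _ n n _ 1 _ 1 _ _ n _ 1]) auto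
  moreover have "B * A = 1\<^sub>m (Suc n)"
    using Q C car w wD one unfolding A B_def
    by (subst mult_four_block_mat[of _ n n _ 1 _ 1 _ _ n _ 1]) auto
  ultimately show ?case by blast
qed

lemma vn_regular_upper_triangular_at_most_one_zero:
  fixes A :: "'a::ring_1 mat"
  assumes div: "is_division_ring TYPE('a)"
    and A: "A \<in> carrier_mat n n" "upper_triangular A"
    and p: "p < n" and nz: "\<And>i. i < n \<Longrightarrow> i \<noteq> p \<Longrightarrow> A $$ (i, i) \<noteq> 0"
  shows "vn_regular (upper_triangular_ring TYPE('a) n) A"
proof -
  text \<open>
    With \<open>E\<close> the matrix unit at a vanishing diagonal entry \<open>p\<close>, the inverse \<open>B\<close> of \<open>A + E\<close> satisfies
    \<open>A B A = A - E + E B E\<close>, and \<open>E B E = E\<close> because \<open>B\<close> has diagonal entry 1 at \<open>p\<close>.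
  \<close>
  define c :: 'a where "c = (if A $$ (p, p) = 0 then 1 else 0)"
  define E where "E = mat n n (\<lambda>(i, j). if i = p \<and> j = p then c else 0)"
  define M where "M = A + E"
  have E: "E \<in> carrier_mat n n" "upper_triangular E"
    unfolding E_def by (auto intro!: upper_triangularI)
  have M: "M \<in> carrier_mat n n" "upper_triangular M"
    using A E by (auto simp: M_def upper_triangularD intro!: upper_triangularI)
  have "M $$ (i, i) \<noteq> 0" if "i < n" for i
    using nz[OF that] that A by (auto simp: M_def E_def c_def)
  then obtain B where B: "B \<in> carrier_mat n n" "upper_triangular B"
    and inv: "M * B = 1\<^sub>m n" "B * M = 1\<^sub>m n"
    using upper_triangular_inverse[OF M] div unfolding is_division_ring_def by blast
  have "M $$ (p, p) * B $$ (p, p) = 1"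
    using upper_triangular_mult_index[OF M B p p] inv p by simp
  then have c: "c * B $$ (p, p) * c = c"
    using p A by (auto simp: M_def E_def c_def)
  have EB: "E * B \<in> carrier_mat n n" using E B by simp
  have EBE: "E * B * E = E"
  proof (rule eq_matI)
    fix i j assume "i < dim_row E" "j < dim_col E"
    then have ij: "i < n" "j < n" using E by auto
    have E_index: "E $$ (k, j) = (if k = p \<and> j = p then c else 0)" if "k < n" for k
      using ij that by (simp add: E_def)
    have EB_index: "(E * B) $$ (i, k) = (if i = p then c * B $$ (p, k) else 0)" if "k < n" for k
    proof -
      have "(E * B) $$ (i, k) = (\<Sum>l = 0..<n. E $$ (i, l) * B $$ (l, k))"
        using ij that E B by (simp add: scalar_prod_def)
      also have "\<dots> = (\<Sum>l = 0..<n. if l = p then E $$ (i, p) * B $$ (p, k) else 0)"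
        using ij by (intro sum.cong) (auto simp: E_def)
      finally show ?thesis using p ij by (simp add: E_def)
    qed
    have "(X * E) $$ (i, j) = (\<Sum>k = 0..<n. X $$ (i, k) * E $$ (k, j))"
      if "X \<in> carrier_mat n n" for X
      using ij E that by (simp add: scalar_prod_def)
    then have "(E * B * E) $$ (i, j) = (\<Sum>k = 0..<n. (E * B) $$ (i, k) * E $$ (k, j))"
      using EB by blast
    also have "\<dots> = (\<Sum>k = 0..<n. if k = p then (E * B) $$ (i, p) * E $$ (p, j) else 0)"
      using ij E_index by (intro sum.cong) auto
    also have "\<dots> = E $$ (i, j)"
      using p ij EB_index[OF p] c by (auto simp: E_def)
    finally show "(E * B * E) $$ (i, j) = E $$ (i, j)" .
  qed (use E B in auto)
  have AM: "A = M - E"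
    using A E by (auto simp: M_def intro!: eq_matI)
  have "A * B = 1\<^sub>m n - E * B"
    using M E B inv unfolding AM by (simp add: minus_mult_distrib_mat)
  then have "A * B * A = (1\<^sub>m n - E * B) * A"
    by simp
  also have "\<dots> = A - E * B * A"
    using A EB by (simp add: minus_mult_distrib_mat[of _ n n])
  \<comment> \<open>Since \<open>B * M = 1\<close>, this difference is \<open>E - E * B * E\<close>,
    which vanishes.\<close>
  also have "E * B * A = E * B * M - E * B * E"
    using EB M E unfolding AM by (simp add: mult_minus_distrib_mat[of _ n n])
  also have "E * B * M = E"
    using E B M inv by (simp add: assoc_mult_mat[of _ n n _ n _ n])
  finally have "A * B * A = A"
    using EBE A E by (auto intro!: eq_matI)
  then show ?thesis
    using A B unfolding vn_regular_upper_triangular_iff by (metis (no_types))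
qed

text \<open>At each diagonal position at most one of \<open>A\<close> and \<open>1 - A\<close>
  vanishes. With at most three positions, one of the two matrices has at most one zero on its
  diagonal.\<close>

lemma division_ring_imp_VNL_upper_triangular:
  assumes div: "is_division_ring TYPE('a::ring_1)" and n: "n = 2 \<or> n = 3"
  shows "VNL_ring (upper_triangular_ring TYPE('a) n)"
  unfolding VNL_upper_triangular_iff
proof (intro ballI impI)
  fix A :: "'a mat" assume A: "A \<in> carrier_mat n n" "upper_triangular A"
  then have A': "1\<^sub>m n - A \<in> carrier_mat n n" "upper_triangular (1\<^sub>m n - A)"
    by (auto intro!: upper_triangularI dest: upper_triangularD)
  have "A $$ (i, i) \<noteq> 0 \<or> (1\<^sub>m n - A) $$ (i, i) \<noteq> 0" if "i < n" for i
    using that A by auto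
  then have "(\<exists>p<n. \<forall>i<n. i \<noteq> p \<longrightarrow> A $$ (i, i) \<noteq> 0) \<or>
      (\<exists>p<n. \<forall>i<n. i \<noteq> p \<longrightarrow> (1\<^sub>m n - A) $$ (i, i) \<noteq> 0)"
    using n by (elim disjE) (simp_all add: numeral_2_eq_2 numeral_3_eq_3 less_Suc_eq all_conj_distrib
        ex_disj_distrib imp_disjL conj_disj_distribR del: index_minus_mat, metis+)
  then show "vn_regular (upper_triangular_ring TYPE('a) n) A \<or>
      vn_regular (upper_triangular_ring TYPE('a) n) (1\<^sub>m n - A)"
    using vn_regular_upper_triangular_at_most_one_zero[OF div A]
      vn_regular_upper_triangular_at_most_one_zero[OF div A'] by blast
qed

text \<open>The bound on \<open>n\<close> excludes \<open>n = 0\<close> and \<open>n = 1\<close>,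
  where the triangular ring over a division ring is VNL as well.\<close>

theorem corollary2p13:
  fixes n :: nat
  assumes "n \<ge> 2"
  shows "VNL_ring (upper_triangular_ring TYPE('a::ring_1) n) \<longleftrightarrow>
         (n = 2 \<or> n = 3) \<and> is_division_ring TYPE('a)"
proof
  assume VNL: "VNL_ring (upper_triangular_ring TYPE('a) n)"
  then have "n \<le> 3"
    by (rule VNL_upper_triangular_imp_le_3)
  then show "(n = 2 \<or> n = 3) \<and> is_division_ring TYPE('a)"
    using VNL_upper_triangular_imp_division_ring[OF VNL assms] assms by auto
next
  assume "(n = 2 \<or> n = 3) \<and> is_division_ring TYPE('a)"
  then show "VNL_ring (upper_triangular_ring TYPE('a) n)"
    using division_ring_imp_VNL_upper_triangular by blast
qed

end
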